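(* Let $f\colon\mathcal H\to\mathbb R$ be Fréchet differentiable and $L_f$-smooth for some $L_f>0$, let $(C_i)_{i\in I}$ be a collection of nonempty compact convex subsets of $\mathcal H$, let $\boldsymbol D$ denote the diagonal subspace of $\boldsymbol{\mathcal H}$, and for every $\lambda\ge0$ set $F_\lambda\colon\boldsymbol x\mapsto f(A\boldsymbol x)+\frac\lambda2\operatorname{dist}_{\boldsymbol D}^2(\boldsymbol x)$. Suppose that $(\lambda_t)_{t\in\mathbb N}$ is a sequence of nonnegative reals with $\lambda_t\nearrow+\infty$. Then $$\lim_{t\to+\infty}\left(\inf_{\boldsymbol x\in\prod_{i\in I}C_i}F_{\lambda_t}(\boldsymbol x)\right)=\inf_{\boldsymbol x\in\prod_{i\in I}C_i}\left(\lim_{t\to+\infty}F_{\lambda_t}(\boldsymbol x)\right)=\inf_{x\in\bigcap_{i\in I}C_i}f(x).$$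
   Context: $\mathcal H$ is a real Hilbert space with inner product $\langle\cdot\mid\cdot\rangle$ and norm $\|\cdot\|$. $m\ge1$ is an integer, $I=\{1,\dots,m\}$, and $\{\omega_i\}_{i\in I}\subset\left]0,1\right]$ satisfies $\sum_{i\in I}\omega_i=1$. $\boldsymbol{\mathcal H}=\mathcal H^m$ is the real Hilbert space with inner product $\langle\boldsymbol x\mid\boldsymbol y\rangle_{\boldsymbol{\mathcal H}}=\sum_{i\in I}\omega_i\langle\boldsymbol x^i\mid\boldsymbol y^i\rangle$, where $\boldsymbol x=(\boldsymbol x^1,\dots,\boldsymbol x^m)$. $\boldsymbol D=\{\boldsymbol x\in\boldsymbol{\mathcal H}:\boldsymbol x^1=\dots=\boldsymbol x^m\}$, and $\operatorname{dist}_{\boldsymbol D}(\boldsymbol x)=\inf_{\boldsymbol z\in\boldsymbol D}\|\boldsymbol x-\boldsymbol z\|_{\boldsymbol{\mathcal H}}$. $A\colon\boldsymbol{\mathcal H}\to\mathcal H\colon\boldsymbol x\mapsto\sum_{i\in I}\omega_i\boldsymbol x^i$. $\prod_{i\in I}C_i=C_1\times\dots\times C_m\subset\boldsymbol{\mathcal H}$. $f$ is $L_f$-smooth if $f(y)-f(x)\le\langle\nabla f(x)\mid y-x\rangle+\frac{L_f}{2}\|y-x\|^2$ for all $x,y\in\mathcal H$. Limits and infima are taken in $[-\infty,+\infty]$, with $\inf\varnothing=+\infty$. *)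

theory Defs
  imports "HOL-Analysis.Analysis"
begin

(* The m-fold product space is the vector type 'h ^ 'm with a finite index type 'm (m = CARD('m)).
   Its library inner product, norm and distance are unweighted, so the weighted versions of the
   product space are defined here and used instead. *)

definition winner :: "('m::finite \<Rightarrow> real) \<Rightarrow> 'h::real_inner ^ 'm \<Rightarrow> 'h ^ 'm \<Rightarrow> real" where
  "winner w x y = (\<Sum>i\<in>UNIV. w i * inner (x $ i) (y $ i))"

definition wnorm :: "('m::finite \<Rightarrow> real) \<Rightarrow> 'h::real_inner ^ 'm \<Rightarrow> real" where
  "wnorm w x = sqrt (winner w x x)"

definition diagonal :: "('h ^ 'm::finite) set" where
  "diagonal = {x. \<forall>i j. x $ i = x $ j}"

(* The infimum is over a nonempty set of nonnegative reals, so the real-valued INF is genuine. *)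
definition dist_diagonal :: "('m::finite \<Rightarrow> real) \<Rightarrow> 'h::real_inner ^ 'm \<Rightarrow> real" where
  "dist_diagonal w x = (INF z\<in>diagonal. wnorm w (x - z))"

definition averaging :: "('m::finite \<Rightarrow> real) \<Rightarrow> 'h::real_vector ^ 'm \<Rightarrow> 'h" where
  "averaging w x = (\<Sum>i\<in>UNIV. w i *\<^sub>R (x $ i))"

definition prod_set :: "('m::finite \<Rightarrow> 'h set) \<Rightarrow> ('h ^ 'm) set" where
  "prod_set C = {x. \<forall>i. x $ i \<in> C i}"

(* Meaningful for functions that are Frechet differentiable at x on a Hilbert space, where
   the Riesz representation theorem gives existence and uniqueness. *)
definition gradient :: "('h::real_inner \<Rightarrow> real) \<Rightarrow> 'h \<Rightarrow> 'h" where
  "gradient f x = (THE g. GDERIV f x :> g)"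

(* One-sided inequality (no absolute value); f is not assumed convex. *)
definition L_smooth :: "real \<Rightarrow> ('h::real_inner \<Rightarrow> real) \<Rightarrow> bool" where
  "L_smooth L f \<longleftrightarrow>
    (\<forall>x y. f y - f x \<le> inner (gradient f x) (y - x) + L / 2 * (norm (y - x))\<^sup>2)"

definition penalized ::
  "('h::real_inner \<Rightarrow> real) \<Rightarrow> ('m::finite \<Rightarrow> real) \<Rightarrow> real \<Rightarrow> 'h ^ 'm \<Rightarrow> real" where
  "penalized f w l x = f (averaging w x) + l / 2 * (dist_diagonal w x)\<^sup>2"

end

theory Submission
  imports Defs
begin

text \<open>
  The penalized functions increase with the parameter, so both limits in the statement are suprema
  over \<open>t\<close>, and the first equality says that this supremum commutes with the infimum over
  \<open>prod_set C\<close>. For an increasing sequence of continuous functions on a compact set this is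
  the covering argument behind Dini's theorem (\<open>SUP_INF_eq_INF_SUP_compact\<close>): if every point
  eventually exceeds a level \<open>a\<close>, then compactness makes a single index work for all points.
  It applies because \<open>prod_set C\<close> is compact (Tychonoff), \<open>f\<close> is continuous, and the
  squared distance to the diagonal is continuous. The last follows from its closed form: the projection of \<open>x\<close>
  onto the diagonal is the constant vector at the weighted mean of \<open>x\<close>
  (\<open>dist_diagonal_power2\<close>).

  For the second equality, the closed form also shows that the distance vanishes exactly on the
  diagonal. Off the diagonal the penalty drives the limit to infinity; on the diagonal the penalty
  is zero, and a constant vector lies in \<open>prod_set C\<close> exactly if its value lies in every
  \<open>C i\<close>. What remains is the infimum of \<open>f\<close> over the intersection.
\<close>

section \<open>Exchanging a monotone limit with an infimum over a compact set\<close>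

text \<open>
  The sets on which \<open>F t\<close> exceeds a given level \<open>a\<close> are relatively open and increase
  with \<open>t\<close>. If they cover \<open>K\<close>, one of them is all of \<open>K\<close>, and then the infimum of
  that \<open>F t\<close> is at least \<open>a\<close>. Density of the order lets \<open>a\<close> approach the right-hand side.
\<close>

lemma SUP_INF_eq_INF_SUP_compact:
  fixes F :: "nat \<Rightarrow> 'a::topological_space \<Rightarrow>
    'b::{complete_linorder, dense_linorder, linorder_topology}"
  assumes K: "compact K"
    and cont: "\<And>t. continuous_on K (F t)"
    and mono: "\<And>x. x \<in> K \<Longrightarrow> incseq (\<lambda>t. F t x)"
  shows "(SUP t. INF x\<in>K. F t x) = (INF x\<in>K. SUP t. F t x)"
proof (rule antisym)
  show "(SUP t. INF x\<in>K. F t x) \<le> (INF x\<in>K. SUP t. F t x)"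
  proof (intro SUP_least INF_greatest)
    fix t x assume "x \<in> K"
    then have "(INF x\<in>K. F t x) \<le> F t x"
      by (rule INF_lower)
    also have "\<dots> \<le> (SUP t. F t x)"
      by (rule SUP_upper[OF UNIV_I])
    finally show "(INF x\<in>K. F t x) \<le> (SUP t. F t x)" .
  qed
  show "(INF x\<in>K. SUP t. F t x) \<le> (SUP t. INF x\<in>K. F t x)"
  proof (rule dense_le)
    fix a assume a: "a < (INF x\<in>K. SUP t. F t x)"
    have "\<exists>T. open T \<and> T \<inter> K = F t -` {a<..} \<inter> K" for t
      using cont[of t, unfolded continuous_on_open_invariant, rule_format, OF open_greaterThan] .
    then obtain T where T: "\<And>t. open (T t)" "\<And>t. T t \<inter> K = F t -` {a<..} \<inter> K"
      by metis
    have mem_T: "x \<in> T t \<longleftrightarrow> a < F t x" if "x \<in> K" for x t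
      using T(2)[of t] that by (metis IntD1 IntI greaterThan_iff vimageE vimageI2)
    have "K \<subseteq> (\<Union>t\<in>UNIV. T t)"
    proof
      fix x assume x: "x \<in> K"
      then have "a < (SUP t. F t x)"
        by (rule less_le_trans[OF a INF_lower])
      then obtain t where "a < F t x"
        by (auto simp: less_SUP_iff)
      then show "x \<in> (\<Union>t\<in>UNIV. T t)"
        using mem_T[OF x] by blast
    qed
    then obtain N where N: "finite N" "K \<subseteq> (\<Union>t\<in>N. T t)"
      by (rule compactE_image[OF K, of UNIV T, rotated]) (use T(1) in auto)
    \<comment> \<open>The index 0 covers the case that \<open>N\<close> is empty.\<close>
    have "a \<le> F (Max (insert 0 N)) x" if x: "x \<in> K" for x
    proof -
      obtain t where t: "t \<in> N" "a < F t x"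
        using N(2) mem_T[OF x] x by blast
      moreover have "F t x \<le> F (Max (insert 0 N)) x"
        by (rule incseqD[OF mono[OF x]]) (use N(1) t(1) in simp)
      ultimately show ?thesis
        by simp
    qed
    then have "a \<le> (INF x\<in>K. F (Max (insert 0 N)) x)"
      by (rule INF_greatest)
    then show "a \<le> (SUP t. INF x\<in>K. F t x)"
      by (rule SUP_upper2[OF UNIV_I])
  qed
qed

text \<open>
  Tychonoff's theorem gives compactness of the set of functions in the product topology; it
  transfers to vectors because \<open>vec_lambda\<close> is continuous for that topology.
\<close>

lemma compact_prod_set:
  fixes C :: "'m::finite \<Rightarrow> 'h::real_normed_vector set"
  assumes "\<And>i. compact (C i)"
  shows "compact (prod_set C)"
proof -
  have "compactin (product_topology (\<lambda>i::'m. euclidean :: 'h topology) UNIV) (PiE UNIV C)"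
    using assms by (simp add: compactin_PiE)
  then have "compact (PiE UNIV C)"
    by (simp add: euclidean_product_topology)
  moreover have "continuous_on (PiE UNIV C) (vec_lambda :: ('m \<Rightarrow> 'h) \<Rightarrow> 'h ^ 'm)"
    using continuous_on_vec_lambda[of "PiE UNIV C" "\<lambda>i g. g i"]
    by (simp add: continuous_on_subset[OF continuous_on_product_coordinates])
  moreover have "prod_set C = vec_lambda ` PiE UNIV C"
  proof (intro equalityI subsetI)
    fix x assume "x \<in> prod_set C"
    then have "vec_nth x \<in> PiE UNIV C"
      by (auto simp: prod_set_def)
    then show "x \<in> vec_lambda ` PiE UNIV C"
      by (metis imageI vec_nth_inverse)
  qed (auto simp: prod_set_def PiE_iff)
  ultimately show ?thesis
    by (simp add: compact_continuous_image)
qed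

section \<open>Distance to the diagonal\<close>

lemma diagonal_eq_range_vec: "diagonal = range (vec :: 'h \<Rightarrow> 'h ^ 'm::finite)"
proof (intro equalityI subsetI)
  fix x :: "'h ^ 'm" assume "x \<in> diagonal"
  then have "x = vec (x $ undefined)"
    by (simp add: diagonal_def vec_eq_iff)
  then show "x \<in> range vec"
    by (rule range_eqI)
qed (auto simp: diagonal_def)

lemma averaging_vec:
  assumes "sum w UNIV = 1"
  shows "averaging w (vec y) = y"
  using assms by (simp add: averaging_def flip: scaleR_left.sum)

text \<open>
  The bias-variance identity: the weighted deviations from the mean sum to zero, so they are
  orthogonal to the constant vectors.
\<close>

lemma winner_diff_vec:
  fixes x :: "'h::real_inner ^ 'm::finite"
  assumes w1: "sum w UNIV = 1"
  shows "winner w (x - vec c) (x - vec c) =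
    (\<Sum>i\<in>UNIV. w i * (norm (x $ i - averaging w x))\<^sup>2) + (norm (averaging w x - c))\<^sup>2"
proof -
  define a where "a = averaging w x"
  have "(\<Sum>i\<in>UNIV. w i *\<^sub>R (x $ i - a)) = 0"
    using w1 by (simp add: a_def averaging_def scaleR_diff_right sum_subtractf flip: scaleR_left.sum)
  then have cross: "(\<Sum>i\<in>UNIV. w i * inner (x $ i - a) (a - c)) = 0"
    by (metis (no_types, lifting) inner_scaleR_left inner_sum_left inner_zero_left sum.cong)
  have "winner w (x - vec c) (x - vec c) =
    (\<Sum>i\<in>UNIV. w i * (norm (x $ i - a))\<^sup>2 + 2 * (w i * inner (x $ i - a) (a - c))
      + w i * (norm (a - c))\<^sup>2)"
    unfolding winner_def
    by (intro sum.cong refl)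
      (simp add: power2_norm_eq_inner inner_diff_left inner_diff_right inner_commute algebra_simps)
  also have "\<dots> = (\<Sum>i\<in>UNIV. w i * (norm (x $ i - a))\<^sup>2) + (norm (a - c))\<^sup>2"
    using cross w1 by (simp add: sum.distrib flip: sum_distrib_left sum_distrib_right)
  finally show ?thesis
    by (simp add: a_def)
qed

text \<open>
  By the preceding identity, the distance from \<open>x\<close> to the constant vector at \<open>c\<close> is smallest
  when \<open>c\<close> is the mean.
\<close>

lemma dist_diagonal_power2:
  fixes x :: "'h::real_inner ^ 'm::finite"
  assumes w0: "\<And>i. 0 \<le> w i" and w1: "sum w UNIV = 1"
  shows "(dist_diagonal w x)\<^sup>2 = (\<Sum>i\<in>UNIV. w i * (norm (x $ i - averaging w x))\<^sup>2)"
    (is "_ = ?S")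
proof -
  have "dist_diagonal w x = sqrt ?S"
    unfolding dist_diagonal_def
  proof (rule cInf_eq_minimum)
    show "sqrt ?S \<in> (\<lambda>z. wnorm w (x - z)) ` diagonal"
      unfolding diagonal_eq_range_vec
      by (rule image_eqI[where x = "vec (averaging w x)"])
        (simp_all add: wnorm_def winner_diff_vec[OF w1])
    show "sqrt ?S \<le> r" if "r \<in> (\<lambda>z. wnorm w (x - z)) ` diagonal" for r
      using that unfolding diagonal_eq_range_vec
      by (auto simp: wnorm_def winner_diff_vec[OF w1])
  qed
  moreover have "0 \<le> ?S"
    using w0 by (simp add: sum_nonneg)
  ultimately show ?thesis
    by simp
qed

lemma dist_diagonal_eq_0_iff:
  fixes x :: "'h::real_inner ^ 'm::finite"
  assumes w0: "\<And>i. 0 < w i" and w1: "sum w UNIV = 1"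
  shows "dist_diagonal w x = 0 \<longleftrightarrow> x = vec (averaging w x)"
proof -
  have "dist_diagonal w x = 0 \<longleftrightarrow> (dist_diagonal w x)\<^sup>2 = 0"
    by simp
  also have "\<dots> \<longleftrightarrow> (\<forall>i. w i * (norm (x $ i - averaging w x))\<^sup>2 = 0)"
    using w0 by (simp add: dist_diagonal_power2[OF less_imp_le w1] sum_nonneg_eq_0_iff less_imp_le)
  also have "\<dots> \<longleftrightarrow> x = vec (averaging w x)"
    using w0 by (simp add: vec_eq_iff less_imp_neq[symmetric])
  finally show ?thesis .
qed

section \<open>The penalized functions\<close>

lemma continuous_on_penalized:
  fixes f :: "'h::real_inner \<Rightarrow> real"
  assumes w0: "\<And>i. 0 \<le> w i" and w1: "sum w UNIV = 1"
    and f: "continuous_on UNIV f"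
  shows "continuous_on S (penalized f w l)"
proof -
  have avg: "continuous_on S (averaging w)"
    unfolding averaging_def by (intro continuous_intros)
  then have "continuous_on S (\<lambda>x. f (averaging w x))"
    using continuous_on_compose2[OF f] by blast
  then show ?thesis
    unfolding penalized_def dist_diagonal_power2[OF w0 w1]
    by (intro continuous_intros avg)
qed

lemma penalized_mono:
  "l \<le> l' \<Longrightarrow> penalized f w l x \<le> penalized f w l' x"
  by (simp add: penalized_def mult_right_mono)

lemma penalized_vec:
  assumes "\<And>i. 0 < w i" and "sum w UNIV = 1"
  shows "penalized f w l (vec y) = f y"
  using assms dist_diagonal_eq_0_iff[OF assms, of "vec y"]
  by (simp add: penalized_def averaging_vec)

text \<open>Off the diagonal the penalty has a positive coefficient, hence it is unbounded.\<close>

lemma SUP_penalized_off_diagonal: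
  fixes x :: "'h::real_inner ^ 'm::finite"
  assumes "\<And>i. 0 < w i" and "sum w UNIV = 1"
    and lam: "filterlim lam at_top sequentially"
    and x: "x \<noteq> vec (averaging w x)"
  shows "(SUP t. ereal (penalized f w (lam t) x)) = \<infinity>"
proof -
  define d where "d = (dist_diagonal w x)\<^sup>2 / 2"
  have d: "d > 0"
    using x dist_diagonal_eq_0_iff[of w x] assms(1,2) by (simp add: d_def)
  have "filterlim (\<lambda>t. f (averaging w x) + d * lam t) at_top sequentially"
    by (intro filterlim_tendsto_add_at_top[OF tendsto_const]
        filterlim_tendsto_pos_mult_at_top[OF tendsto_const d] lam)
  then have unbounded: "filterlim (\<lambda>t. penalized f w (lam t) x) at_top sequentially"
    by (simp add: penalized_def d_def mult.commute)
  show ?thesis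
  proof (rule ereal_top)
    fix B
    obtain t where "B \<le> penalized f w (lam t) x"
      using unbounded[unfolded filterlim_at_top, rule_format, of B]
      by (auto dest: eventually_happens)
    then show "ereal B \<le> (SUP t. ereal (penalized f w (lam t) x))"
      by (intro SUP_upper2[of t]) simp_all
  qed
qed

text \<open>
  In the limit, the penalty acts as the constraint that all components are equal. The intersection
  may be empty; then both infima are infinite.
\<close>

lemma INF_SUP_penalized:
  fixes C :: "'m::finite \<Rightarrow> 'h::real_inner set"
  assumes w0: "\<And>i. 0 < w i" and w1: "sum w UNIV = 1"
    and lam: "filterlim lam at_top sequentially"
  shows "(INF x\<in>prod_set C. SUP t. ereal (penalized f w (lam t) x)) = (INF y\<in>(\<Inter>i. C i). ereal (f y))"
proof (rule antisym)
  show "(INF x\<in>prod_set C. SUP t. ereal (penalized f w (lam t) x)) \<le> (INF y\<in>(\<Inter>i. C i). ereal (f y))"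
  proof (rule INF_greatest)
    fix y assume "y \<in> (\<Inter>i. C i)"
    then have "vec y \<in> prod_set C"
      by (simp add: prod_set_def)
    then show "(INF x\<in>prod_set C. SUP t. ereal (penalized f w (lam t) x)) \<le> ereal (f y)"
      by (rule INF_lower2) (simp add: penalized_vec[OF w0 w1])
  qed
  show "(INF y\<in>(\<Inter>i. C i). ereal (f y)) \<le> (INF x\<in>prod_set C. SUP t. ereal (penalized f w (lam t) x))"
  proof (rule INF_greatest)
    fix x assume x: "x \<in> prod_set C"
    show "(INF y\<in>(\<Inter>i. C i). ereal (f y)) \<le> (SUP t. ereal (penalized f w (lam t) x))"
    proof (cases "x = vec (averaging w x)")
      case True
      define a where "a = averaging w x"
      have xa: "x = vec a"
        using True by (simp add: a_def)
      then have "a \<in> (\<Inter>i. C i)"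
        using x by (simp add: prod_set_def)
      then show ?thesis
        unfolding xa by (intro INF_lower2[of a]) (simp_all add: penalized_vec[OF w0 w1])
    next
      case False
      then show ?thesis
        by (simp add: SUP_penalized_off_diagonal[OF w0 w1 lam])
    qed
  qed
qed

theorem proposition2p15:
  fixes f :: "'h::{real_inner, complete_space} \<Rightarrow> real"
    and w :: "'m::finite \<Rightarrow> real"
    and C :: "'m \<Rightarrow> 'h set"
    and L :: real
    and lam :: "nat \<Rightarrow> real"
  assumes "\<And>i. 0 < w i \<and> w i \<le> 1"
    and "(\<Sum>i\<in>UNIV. w i) = 1"
    and "\<And>x. f differentiable (at x)"
    and "L > 0"
    and "L_smooth L f"
    and "\<And>i. C i \<noteq> {} \<and> compact (C i) \<and> convex (C i)"
    and "\<And>t. lam t \<ge> 0"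
    and "incseq lam"
    and "filterlim lam at_top sequentially"
  shows "convergent (\<lambda>t. INF x\<in>prod_set C. ereal (penalized f w (lam t) x))
    \<and> (\<forall>x\<in>prod_set C. convergent (\<lambda>t. ereal (penalized f w (lam t) x)))
    \<and> lim (\<lambda>t. INF x\<in>prod_set C. ereal (penalized f w (lam t) x))
        = (INF x\<in>prod_set C. lim (\<lambda>t. ereal (penalized f w (lam t) x)))
    \<and> (INF x\<in>prod_set C. lim (\<lambda>t. ereal (penalized f w (lam t) x)))
        = (INF x\<in>(\<Inter>i. C i). ereal (f x))"
proof -
  let ?F = "\<lambda>t x. ereal (penalized f w (lam t) x)"
  have w0: "0 < w i" for i
    using assms(1) by blast
  have "continuous_on UNIV f"
    using assms(3) by (simp add: continuous_at_imp_continuous_on differentiable_imp_continuous_within)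
  then have cont: "continuous_on (prod_set C) (?F t)" for t
    by (intro continuous_on_ereal continuous_on_penalized less_imp_le[OF w0] assms(2))
  have mono: "incseq (\<lambda>t. ?F t x)" for x
    using assms(8) by (auto simp: incseq_def intro: penalized_mono)
  then have mono_INF: "incseq (\<lambda>t. INF x\<in>prod_set C. ?F t x)"
    unfolding incseq_def by (intro allI impI INF_superset_mono) auto
  have lim_INF: "(\<lambda>t. INF x\<in>prod_set C. ?F t x) \<longlonglongrightarrow> (SUP t. INF x\<in>prod_set C. ?F t x)"
    by (rule LIMSEQ_SUP[OF mono_INF])
  have lim_F: "(\<lambda>t. ?F t x) \<longlonglongrightarrow> (SUP t. ?F t x)" for x
    by (rule LIMSEQ_SUP[OF mono])
  have exchange: "(SUP t. INF x\<in>prod_set C. ?F t x) = (INF x\<in>prod_set C. SUP t. ?F t x)"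
    using assms(6) cont mono by (intro SUP_INF_eq_INF_SUP_compact compact_prod_set) auto
  have constraint: "(INF x\<in>prod_set C. SUP t. ?F t x) = (INF y\<in>(\<Inter>i. C i). ereal (f y))"
    by (rule INF_SUP_penalized[OF w0 assms(2,9)])
  show ?thesis
    unfolding limI[OF lim_INF] limI[OF lim_F]
    using lim_INF lim_F exchange constraint by (auto simp: convergent_def)
qed

end
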